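(* If $G$ is a connected block graph of order $n$ whose clique number equals $\omega$, then $cs(G)\leq \max\{ \lceil n/3\rceil,\lceil \omega/2\rceil\}$.
   Context: A block graph is a graph all of whose blocks (maximal 2-connected subgraphs or bridges) are complete graphs. For a graph $G$, a set $S\subseteq V(G)$ is a safe set if $|V(C)|\geq |V(D)|$ for every component $C$ of the induced subgraph $G[S]$ and every component $D$ of $G-S$ (induced by $V(G)\setminus S$) such that some vertex of $C$ is adjacent to some vertex of $D$. The connected safe number $cs(G)$ is the smallest cardinality of a safe set $S$ in $G$ such that $G[S]$ is connected. *)

theory Defs
  imports Complex_Main "Graph_Theory.Graph_Theory"
begin

text \<open>
  Finite simple graphs are the locale \<^locale>\<open>graph\<close>: finite, loop-free, symmetric digraphs
  without parallel arcs, so that an undirected edge is a pair of opposite arcs. For symmetric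
  graphs the connected components are the strongly connected components
  \<^const>\<open>pre_digraph.sccs\<close>. Note that \<^const>\<open>connected\<close> excludes the null graph.
\<close>

definition two_connected :: "('a,'b) pre_digraph \<Rightarrow> bool" where
  "two_connected H \<longleftrightarrow> graph H \<and> 3 \<le> card (verts H) \<and> connected H \<and>
     (\<forall>v \<in> verts H. connected (pre_digraph.del_vert H v))"

text \<open>Deletion of the undirected edge carried by the arc \<open>e\<close>, i.e. of both of its arcs.\<close>

definition del_edge :: "('a,'b) pre_digraph \<Rightarrow> 'b \<Rightarrow> ('a,'b) pre_digraph" where
  "del_edge G e = \<lparr> verts = verts G,
     arcs = {a \<in> arcs G. {tail G a, head G a} \<noteq> {tail G e, head G e}},
     tail = tail G, head = head G \<rparr>"

definition bridge :: "('a,'b) pre_digraph \<Rightarrow> 'b \<Rightarrow> bool" where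
  "bridge G e \<longleftrightarrow> e \<in> arcs G \<and> \<not> tail G e \<rightarrow>\<^sup>*\<^bsub>del_edge G e\<^esub> head G e"

text \<open>A bridge, viewed as a subgraph, consists of the edge together with its two ends.\<close>

definition block :: "('a,'b) pre_digraph \<Rightarrow> ('a,'b) pre_digraph \<Rightarrow> bool" where
  "block G B \<longleftrightarrow> pre_digraph.max_subgraph G two_connected B \<or>
     (\<exists>e. bridge G e \<and> B = G \<restriction> {tail G e, head G e})"

definition complete_graph :: "('a,'b) pre_digraph \<Rightarrow> bool" where
  "complete_graph H \<longleftrightarrow> complete_digraph (card (verts H)) H"

definition block_graph :: "('a,'b) pre_digraph \<Rightarrow> bool" where
  "block_graph G \<longleftrightarrow> graph G \<and> (\<forall>B. block G B \<longrightarrow> complete_graph B)"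

definition clique_number :: "('a,'b) pre_digraph \<Rightarrow> nat" where
  "clique_number G = Max {card W | W. W \<subseteq> verts G \<and> complete_graph (G \<restriction> W)}"

definition safe_set :: "('a,'b) pre_digraph \<Rightarrow> 'a set \<Rightarrow> bool" where
  "safe_set G S \<longleftrightarrow> S \<subseteq> verts G \<and>
     (\<forall>C \<in> pre_digraph.sccs (G \<restriction> S). \<forall>D \<in> pre_digraph.sccs (G \<restriction> (verts G - S)).
        (\<exists>u \<in> verts C. \<exists>v \<in> verts D. u \<rightarrow>\<^bsub>G\<^esub> v) \<longrightarrow> card (verts D) \<le> card (verts C))"

text \<open>
  The empty set is vacuously safe; it does not count here because the null graph is not connected.
\<close>

definition connected_safe_number :: "('a,'b) pre_digraph \<Rightarrow> nat" where
  "connected_safe_number G = Min {card S | S. safe_set G S \<and> connected (G \<restriction> S)}"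

end

theory Submission
  imports Defs
begin

text \<open>
  Let \<open>k\<close> be the asserted bound. Among the connected sets of \<open>k\<close> vertices choose one, \<open>S\<close>, for which
  the largest component \<open>D\<close> of \<open>G - S\<close> is as small as possible, and suppose that \<open>D\<close> has more than
  \<open>k\<close> vertices. Then less than \<open>k\<close> vertices lie outside \<open>S \<union> D\<close>, because \<open>n \<le> 3 k\<close>. All edges between
  \<open>S\<close> and \<open>D\<close> lie in a single block, so the set \<open>A\<close> of their ends in \<open>S\<close> and the set \<open>C\<close> of their
  ends in \<open>D\<close> together form a clique. Exchanging a vertex \<open>x \<in> S\<close> for a vertex \<open>c \<in> C\<close>
  leaves only components smaller than \<open>D\<close>, a contradiction:
  \<^item> If \<open>A \<noteq> S\<close>, take \<open>x \<in> S - A\<close> such that \<open>S - {x}\<close> is connected, and any \<open>c \<in> C\<close>. The vertex \<open>x\<close>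
    joins only vertices outside \<open>S \<union> D\<close>, at most \<open>k - 1\<close> of them.
  \<^item> If \<open>A = S\<close>, the clique \<open>S \<union> C\<close> has at most \<open>\<omega> \<le> 2 k\<close> vertices, so \<open>C\<close> is a proper subset of \<open>D\<close>.
    Take \<open>c \<in> C\<close> with a neighbour \<open>e \<in> D - C\<close>, and \<open>x \<in> S\<close> without neighbours outside \<open>S \<union> D\<close>. Then
    \<open>c\<close> separates \<open>e\<close> from \<open>x\<close>.
\<close>

section \<open>Connected vertex sets\<close>

text \<open>\<open>rtrancl_on X E\<close> keeps walks inside \<open>X\<close>, so induced subgraphs
  can be handled as bare vertex sets. The empty set is excluded, as in
  \<open>connected\<close>.\<close>

definition connected_in :: "('a \<times> 'a) set \<Rightarrow> 'a set \<Rightarrow> bool" where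
  "connected_in E X \<longleftrightarrow> X \<noteq> {} \<and> (\<forall>u\<in>X. \<forall>v\<in>X. (u,v) \<in> rtrancl_on X E)"

lemma connected_in_singleton: "connected_in E {x}"
  by (simp add: connected_in_def)

lemma connected_in_Un:
  assumes X: "connected_in E X" and Y: "connected_in E Y" and "X \<inter> Y \<noteq> {}"
  shows "connected_in E (X \<union> Y)"
proof -
  obtain z where z: "z \<in> X" "z \<in> Y" using assms by blast
  have "(u,z) \<in> rtrancl_on (X \<union> Y) E \<and> (z,u) \<in> rtrancl_on (X \<union> Y) E" if "u \<in> X \<union> Y" for u
    using that z X Y unfolding connected_in_def
    by (auto intro: rtrancl_on_mono[OF subset_refl])
  then show ?thesis
    using z unfolding connected_in_def by (blast intro: rtrancl_on_trans)
qed

lemma connected_in_clique: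
  assumes "X \<noteq> {}" "pairwise (\<lambda>x y. (x,y) \<in> E) X"
  shows "connected_in E X"
proof -
  have "(u,v) \<in> rtrancl_on X E" if "u \<in> X" "v \<in> X" for u v
  proof (cases "u = v")
    case True
    then show ?thesis using that by simp
  next
    case False
    then have "(u,v) \<in> E" using assms(2) that by (simp add: pairwise_def)
    then show ?thesis using that by (meson converse_rtrancl_on_into_rtrancl_on rtrancl_on_refl)
  qed
  then show ?thesis using assms(1) by (simp add: connected_in_def)
qed

lemma connected_in_insert:
  assumes "sym E" "connected_in E X" "x \<in> X" "(x,y) \<in> E"
  shows "connected_in E (insert y X)"
proof -
  have "connected_in E {x,y}"
    using assms(1,4) by (intro connected_in_clique) (auto simp: pairwise_def dest: symD)
  from connected_in_Un[OF assms(2) this] show ?thesis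
    using assms(3) by (simp add: insert_absorb)
qed

text \<open>A walk inside \<open>X\<close> from \<open>A\<close> to a vertex outside
  \<open>A\<close> must step out of \<open>A\<close> somewhere.\<close>

lemma connected_in_crossing_edge:
  assumes "connected_in E X" "X \<inter> A \<noteq> {}" "\<not> X \<subseteq> A"
  obtains a b where "a \<in> X \<inter> A" "b \<in> X - A" "(a,b) \<in> E"
proof -
  obtain a b where ab: "a \<in> X \<inter> A" "b \<in> X - A" using assms(2,3) by blast
  have "(a,b) \<in> rtrancl_on X E" using assms(1) ab by (simp add: connected_in_def)
  then have "b \<in> A \<or> (\<exists>x\<in>X \<inter> A. \<exists>y\<in>X - A. (x,y) \<in> E)"
    by (induction rule: rtrancl_on_induct) (use ab in auto)
  then show ?thesis using ab that by blast
qed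

lemma connected_in_separated:
  assumes "connected_in E F" "F \<subseteq> X \<union> Y" "\<And>x y. x \<in> X \<Longrightarrow> y \<in> Y \<Longrightarrow> (x,y) \<notin> E"
  shows "F \<subseteq> X \<or> F \<subseteq> Y"
proof (rule ccontr)
  assume neg: "\<not> (F \<subseteq> X \<or> F \<subseteq> Y)"
  then have "F \<inter> X \<noteq> {}" "\<not> F \<subseteq> X" using assms(2) by blast+
  from connected_in_crossing_edge[OF assms(1) this] show False
    using assms(2,3) by blast
qed

section \<open>Growing and shrinking connected sets by one vertex\<close>

lemma connected_in_subset_card:
  assumes "sym E" "finite V" "connected_in E V" "1 \<le> k" "k \<le> card V"
  obtains S where "S \<subseteq> V" "card S = k" "connected_in E S"
proof -
  have "\<exists>S\<subseteq>V. card S = k \<and> connected_in E S"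
    using \<open>1 \<le> k\<close> \<open>k \<le> card V\<close>
  proof (induction k rule: dec_induct)
    case base
    from assms(3) obtain v where "v \<in> V" by (auto simp: connected_in_def)
    then show ?case by (intro exI[of _ "{v}"]) (simp add: connected_in_singleton)
  next
    case (step m)
    then obtain S where S: "S \<subseteq> V" "card S = m" "connected_in E S" by auto
    then have "V \<inter> S \<noteq> {}" "\<not> V \<subseteq> S"
      using step.prems assms(2) by (auto simp: connected_in_def dest: antisym)
    then obtain a b where "a \<in> V \<inter> S" "b \<in> V - S" "(a,b) \<in> E"
      by (rule connected_in_crossing_edge[OF assms(3)])
    then show ?case
      using S assms(1,2)
      by (intro exI[of _ "insert b S"]) (auto intro: connected_in_insert simp: finite_subset)
  qed
  then show ?thesis using that by blast
qed

text \<open>A largest connected proper subset of \<open>S\<close> containing \<open>A\<close> misses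
  exactly one vertex: it can be extended along an edge leaving it, and by maximality the extension
  is \<open>S\<close>.\<close>

lemma connected_in_removable_vertex:
  assumes "sym E" "finite S" "connected_in E S" "connected_in E A" "A \<subset> S"
  obtains x where "x \<in> S - A" "connected_in E (S - {x})"
proof -
  let ?P = "\<lambda>T. connected_in E T \<and> A \<subseteq> T \<and> T \<subset> S"
  have "\<exists>T. ?P T \<and> (\<forall>T'. ?P T' \<longrightarrow> card T' \<le> card T)"
  proof (rule ex_has_greatest_nat)
    show "?P A" using assms by simp
    show "\<forall>T. ?P T \<longrightarrow> card T < Suc (card S)"
      using assms(2) by (auto simp: less_Suc_eq_le intro: card_mono)
  qed
  then obtain T where T: "?P T" and max: "\<And>T'. ?P T' \<Longrightarrow> card T' \<le> card T" by blast
  have "S \<inter> T \<noteq> {}" "\<not> S \<subseteq> T" using T by (auto simp: connected_in_def)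
  then obtain a b where ab: "a \<in> S \<inter> T" "b \<in> S - T" "(a,b) \<in> E"
    by (rule connected_in_crossing_edge[OF assms(3)])
  have conn: "connected_in E (insert b T)"
    using T ab assms(1) by (auto intro: connected_in_insert)
  have "finite T" using T assms(2) by (auto intro: finite_subset)
  then have "\<not> card (insert b T) \<le> card T" using ab by simp
  then have "insert b T = S" using max[of "insert b T"] T ab conn by blast
  then have "S - {b} = T" using ab by blast
  then show ?thesis using that[of b] T ab by auto
qed

text \<open>Cut the walk at its last visit to \<open>s\<close>. The induction builds the walk
  backwards from \<open>t\<close>, so the first visit it meets is the last one.\<close>

lemma rtrancl_on_first_step:
  assumes "(s,t) \<in> rtrancl_on X E" "s \<noteq> t"
  obtains r where "(s,r) \<in> E" "(r,t) \<in> rtrancl_on (X - {s}) E"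
proof -
  have "(x,t) \<in> rtrancl_on (X - {s}) E \<or> (\<exists>r. (s,r) \<in> E \<and> (r,t) \<in> rtrancl_on (X - {s}) E)"
    if "(x,t) \<in> rtrancl_on X E" for x
    using that
  proof (induction rule: converse_rtrancl_on_induct)
    case base
    then show ?case using assms(2) by simp
  next
    case (step x y)
    show ?case
    proof (cases "x = s")
      case True
      then show ?thesis using step by blast
    next
      case False
      then show ?thesis using step by (meson converse_rtrancl_on_into_rtrancl_on DiffI singletonD)
    qed
  qed
  from this[OF assms(1)] show ?thesis
    using that in_rtrancl_on_in_F(1) by fastforce
qed

lemma card_insert_Diff_singleton:
  assumes "finite S" "x \<in> S" "c \<notin> S"
  shows "card (insert c (S - {x})) = card S"
  using assms by (metis DiffD1 card_Suc_Diff1 card_insert_disjoint finite_Diff)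

section \<open>Exchanging vertices in block graphs\<close>

text \<open>
  The last assumption says that two neighbours of \<open>c\<close> on a common cycle through \<open>c\<close> are adjacent; it is
  the only property of block graphs that the exchange argument needs.
\<close>

locale block_adjacency =
  fixes E :: "('a \<times> 'a) set"
  assumes sym_adj: "sym E"
    and cyclic_neighbours_adj:
      "\<lbrakk>(c,u) \<in> E; (c,v) \<in> E; u \<noteq> v; c \<notin> X; (u,v) \<in> rtrancl_on X E\<rbrakk> \<Longrightarrow> (u,v) \<in> E"
begin

lemma adj_commute: "(x,y) \<in> E \<longleftrightarrow> (y,x) \<in> E"
  using sym_adj by (auto dest: symD)

text \<open>Adjacency to \<open>d\<close> is passed along the walk from \<open>s\<close> to
  \<open>t\<close>. The next vertex \<open>r\<close> and \<open>d\<close> are neighbours of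
  \<open>s\<close>, and the rest of the walk followed by a path from \<open>e\<close> to
  \<open>d\<close> in \<open>D\<close> joins them without \<open>s\<close>. Hence \<open>r\<close>
  is adjacent to \<open>d\<close> and replaces \<open>s\<close>.\<close>

lemma neighbours_complete:
  assumes "finite X" "(s,t) \<in> rtrancl_on X E" "connected_in E D" "X \<inter> D = {}"
    and "d \<in> D" "e \<in> D" "(s,d) \<in> E" "(t,e) \<in> E"
  shows "(t,d) \<in> E"
  using assms(1,2,4,7)
proof (induction "card X" arbitrary: X s rule: less_induct)
  case less
  show ?case
  proof (cases "s = t")
    case True
    then show ?thesis using less by simp
  next
    case False
    then obtain r where r: "(s,r) \<in> E" "(r,t) \<in> rtrancl_on (X - {s}) E"
      using rtrancl_on_first_step[OF less.prems(2)] by metis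
    have s: "s \<in> X" using less.prems(2) by (rule in_rtrancl_on_in_F)
    have rt: "r \<in> X - {s}" "t \<in> X - {s}" using r(2) by (auto dest: in_rtrancl_on_in_F)
    let ?Y = "(X - {s}) \<union> D"
    have "(r,t) \<in> rtrancl_on ?Y E" by (rule rtrancl_on_mono[OF _ _ r(2)]) auto
    moreover have "(e,d) \<in> rtrancl_on ?Y E"
      by (rule rtrancl_on_mono[of E E D]) (use assms(3,5,6) in \<open>auto simp: connected_in_def\<close>)
    then have "(t,d) \<in> rtrancl_on ?Y E"
      using assms(8) rt(2) by (blast intro: converse_rtrancl_on_into_rtrancl_on)
    ultimately have "(r,d) \<in> rtrancl_on ?Y E" by (rule rtrancl_on_trans)
    moreover have "s \<notin> ?Y" "r \<noteq> d" using s rt less.prems(3) assms(5) by auto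
    ultimately have "(r,d) \<in> E"
      using cyclic_neighbours_adj[of s r d ?Y] r(1) less.prems(4) by simp
    moreover have "card (X - {s}) < card X"
      using less.prems(1) s by (rule card_Diff1_less)
    ultimately show ?thesis
      using less.hyps[of "X - {s}" r] less.prems(1,3) r(2) by auto
  qed
qed

text \<open>
  The connected sets \<open>F\<close> stand in for the components: bounding all of them avoids maximality.
\<close>

lemma exchange_decreases_components:
  assumes "finite V" and V: "connected_in E V" and card_V: "card V \<le> 3 * k"
    and cliques: "\<And>W. W \<subseteq> V \<Longrightarrow> pairwise (\<lambda>x y. (x,y) \<in> E) W \<Longrightarrow> card W \<le> 2 * k"
    and S: "S \<subseteq> V" "connected_in E S" "card S = k"
    and D: "D \<subseteq> V - S" "connected_in E D" "k < card D"
    and D_comp: "\<And>x y. x \<in> D \<Longrightarrow> y \<in> V - S - D \<Longrightarrow> (x,y) \<notin> E"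
  obtains S' where "S' \<subseteq> V" "card S' = k" "connected_in E S'"
    "\<And>F. F \<subseteq> V - S' \<Longrightarrow> connected_in E F \<Longrightarrow> card F < card D"
proof -
  define A where "A = {s\<in>S. \<exists>d\<in>D. (s,d) \<in> E}"
  define C where "C = {d\<in>D. \<exists>s\<in>S. (s,d) \<in> E}"
  define R where "R = V - S - D"
  have fin: "finite S" "finite D" "finite R"
    using S(1) D(1) \<open>finite V\<close> by (auto simp: R_def intro: finite_subset)
  have AC: "(s,d) \<in> E" if sd: "s \<in> A" "d \<in> C" for s d
  proof -
    obtain t where "t \<in> S" "(t,d) \<in> E" using sd by (auto simp: C_def)
    moreover obtain e where "e \<in> D" "(s,e) \<in> E" using sd by (auto simp: A_def)
    moreover have "s \<in> S" "d \<in> D" using sd by (auto simp: A_def C_def)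
    ultimately show ?thesis
      using neighbours_complete[of S t s D d e] S D fin by (auto simp: connected_in_def)
  qed
  \<comment> \<open>By \<open>AC\<close>, \<open>s\<close> and \<open>t\<close> have the common
    neighbour \<open>d\<close>, and \<open>S\<close> joins them without \<open>d\<close>. For
    \<open>C_clique\<close> the roles are swapped, with \<open>D\<close> as the joining set.\<close>
  have A_clique: "(s,t) \<in> E" if "s \<in> A" "t \<in> A" "s \<noteq> t" "d \<in> C" for s t d
    using cyclic_neighbours_adj[of d s t S] AC[of s d] AC[of t d] that S(2) D(1)
    by (auto simp: connected_in_def A_def C_def adj_commute)
  have C_clique: "(d,e) \<in> E" if "d \<in> C" "e \<in> C" "d \<noteq> e" "s \<in> A" for d e s
    using cyclic_neighbours_adj[of s d e D] AC[of s d] AC[of s e] that D(1,2)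
    by (auto simp: connected_in_def A_def C_def)
  \<comment> \<open>An edge leaving \<open>D\<close> must end in \<open>S\<close>, as
    \<open>D_comp\<close> rules out all other vertices; so \<open>A\<close> and \<open>C\<close> are
    nonempty.\<close>
  have "V \<inter> S \<noteq> {}" "V \<inter> D \<noteq> {}" "\<not> V \<subseteq> D"
    using S D by (auto simp: connected_in_def)
  then obtain d s where ds: "d \<in> V \<inter> D" "s \<in> V - D" "(d,s) \<in> E"
    using connected_in_crossing_edge[OF V] by metis
  then have "s \<in> S" using D_comp by blast
  then have ne: "s \<in> A" "d \<in> C" using ds by (auto simp: A_def C_def adj_commute)
  have "card V = card S + card D + card R"
  proof -
    have "V = S \<union> D \<union> R" using S(1) D(1) by (auto simp: R_def)
    moreover have "card (S \<union> D \<union> R) = card (S \<union> D) + card R"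
      by (rule card_Un_disjoint) (use fin in \<open>auto simp: R_def\<close>)
    moreover have "card (S \<union> D) = card S + card D"
      by (rule card_Un_disjoint) (use fin D(1) in auto)
    ultimately show ?thesis by simp
  qed
  then have card_R: "card R < k" using card_V S(3) D(3) by simp
  have DR: "x \<in> D \<Longrightarrow> y \<in> R \<Longrightarrow> (x,y) \<notin> E" for x y
    using D_comp by (auto simp: R_def)
  have card_exchange: "card (insert c (S - {x})) = k" if "x \<in> S" "c \<in> D" for c x
    using card_insert_Diff_singleton[of S x c] that fin S(3) D(1) by auto
  show ?thesis
  proof (cases "A = S")
    case False
    then have "A \<subset> S" by (auto simp: A_def)
    moreover have "connected_in E A"
      using ne A_clique by (intro connected_in_clique) (auto simp: pairwise_def)
    ultimately obtain x where x: "x \<in> S - A" "connected_in E (S - {x})"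
      using connected_in_removable_vertex[OF sym_adj fin(1) S(2)] by metis
    let ?S' = "insert d (S - {x})"
    show ?thesis
    proof (rule that)
      show "?S' \<subseteq> V" using S(1) ds by auto
      show "card ?S' = k" using card_exchange x ds by simp
      have "s \<in> S - {x}" using x ne \<open>s \<in> S\<close> by auto
      then show "connected_in E ?S'"
        using connected_in_insert[OF sym_adj x(2)] ds(3) by (simp add: adj_commute)
    next
      fix F assume F: "F \<subseteq> V - ?S'" "connected_in E F"
      \<comment> \<open>Since \<open>x\<close> is not in \<open>A\<close>, it has no neighbour in
        \<open>D\<close> and can only join vertices of \<open>R\<close>.\<close>
      have "F \<subseteq> (D - {d}) \<union> insert x R" using F(1) by (auto simp: R_def)
      moreover have "(a,b) \<notin> E" if "a \<in> D - {d}" "b \<in> insert x R" for a b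
        using that DR x by (auto simp: A_def adj_commute)
      ultimately have "F \<subseteq> D - {d} \<or> F \<subseteq> insert x R"
        using connected_in_separated[OF F(2)] by metis
      then show "card F < card D"
      proof
        assume "F \<subseteq> D - {d}"
        then have "card F \<le> card (D - {d})" using fin by (intro card_mono) auto
        also have "\<dots> < card D" using fin ds by (intro card_Diff1_less) auto
        finally show ?thesis .
      next
        assume "F \<subseteq> insert x R"
        then have "card F \<le> card (insert x R)" using fin by (intro card_mono) auto
        also have "\<dots> \<le> Suc (card R)" by (rule card_insert_le_m1) simp_all
        finally show ?thesis using card_R D(3) by simp
      qed
    qed
  next
    case True
    have CA: "(d,s) \<in> E" if "d \<in> C" "s \<in> A" for s d
      using AC[OF that(2,1)] sym_adj by (rule symD[rotated])
    have clique: "pairwise (\<lambda>x y. (x,y) \<in> E) (S \<union> C)"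
      using AC CA A_clique C_clique ne True by (auto simp: pairwise_def)
    then have "card (S \<union> C) \<le> 2 * k"
      using cliques[of "S \<union> C"] S(1) D(1) by (auto simp: C_def)
    moreover have "card (S \<union> C) = card S + card C"
      using fin D(1) by (intro card_Un_disjoint) (auto simp: C_def)
    ultimately have "card C \<le> k" using S(3) by simp
    moreover have "finite C" using fin by (simp add: C_def)
    ultimately have "\<not> D \<subseteq> C" using D(3) card_mono[of C D] by auto
    moreover have "D \<inter> C \<noteq> {}" using ne by (auto simp: C_def)
    ultimately obtain c e where ce: "c \<in> D \<inter> C" "e \<in> D - C" "(c,e) \<in> E"
      using connected_in_crossing_edge[OF D(2)] by metis
    \<comment> \<open>Pigeonhole: otherwise every vertex of \<open>S\<close> selects a neighbour in
      \<open>R\<close>, and distinct vertices select distinct ones, although \<open>R\<close> has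
      fewer than \<open>k\<close> elements.\<close>
    obtain x where x: "x \<in> S" "\<And>r. r \<in> R \<Longrightarrow> (x,r) \<notin> E"
    proof -
      have "\<exists>x\<in>S. \<forall>r\<in>R. (x,r) \<notin> E"
      proof (rule ccontr)
        assume "\<not> ?thesis"
        then obtain f where f: "\<And>x. x \<in> S \<Longrightarrow> f x \<in> R \<and> (x, f x) \<in> E" by metis
        \<comment> \<open>A common neighbour in \<open>R\<close> of two vertices of \<open>S\<close> would lie on a cycle with \<open>c\<close>.\<close>
        have "inj_on f S"
        proof (rule inj_onI, rule ccontr)
          fix x y assume xy: "x \<in> S" "y \<in> S" "f x = f y" "x \<noteq> y"
          have "connected_in E {f x, y, c}"
          proof -
            have "connected_in E {y, c}"
              using True xy ce by (intro connected_in_clique pairwise_subset[OF clique]) auto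
            then show ?thesis
              using connected_in_insert[OF sym_adj, of "{y,c}" y "f x"] f[OF xy(2)] xy(3) by simp
          qed
          then have "(c, f x) \<in> rtrancl_on {f x, y, c} E" by (simp add: connected_in_def)
          moreover have "x \<notin> {f x, y, c}" "c \<noteq> f x"
            using xy f[OF xy(1)] ce D(1) by (auto simp: R_def)
          ultimately have "(c, f x) \<in> E"
            using cyclic_neighbours_adj[of x c "f x" "{f x, y, c}"] AC[of x c] True
              f[OF xy(1)] xy(1) ce
            by blast
          then show False using DR[of c "f x"] f[OF xy(1)] ce by blast
        qed
        then have "card S \<le> card R" using f fin by (intro card_inj_on_le[of f]) auto
        then show False using card_R S(3) by simp
      qed
      then show ?thesis using that by blast
    qed
    let ?S' = "insert c (S - {x})"
    show ?thesis
    proof (rule that)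
      show "?S' \<subseteq> V" using S(1) D(1) ce by auto
      show "card ?S' = k" using card_exchange x ce by simp
      show "connected_in E ?S'"
        using ce by (intro connected_in_clique pairwise_subset[OF clique]) auto
    next
      fix F assume F: "F \<subseteq> V - ?S'" "connected_in E F"
      \<comment> \<open>\<open>?T\<close> has exactly as many vertices as \<open>D\<close>, so only
        \<open>F = ?T\<close> has to be excluded.\<close>
      let ?T = "insert x (D - {c})"
      have "F \<subseteq> ?T \<union> R" using F(1) by (auto simp: R_def)
      moreover have "(a,b) \<notin> E" if "a \<in> ?T" "b \<in> R" for a b
        using that DR x by auto
      ultimately have "F \<subseteq> ?T \<or> F \<subseteq> R"
        using connected_in_separated[OF F(2)] by metis
      then show "card F < card D"
      proof
        assume FT: "F \<subseteq> ?T"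
        have xe: "x \<noteq> e" "(x,e) \<notin> E" using x ce D(1) by (auto simp: C_def)
        \<comment> \<open>Otherwise \<open>x\<close> and \<open>e\<close>, both neighbours of
          \<open>c\<close>, would be joined without \<open>c\<close> and thus adjacent, although
          \<open>e\<close> lies outside \<open>C\<close>.\<close>
        have "F \<noteq> ?T"
        proof
          assume "F = ?T"
          then have "(x,e) \<in> rtrancl_on ?T E"
            using F(2) ce by (auto simp: connected_in_def)
          moreover have "c \<notin> ?T" using x(1) ce D(1) by auto
          ultimately have "(x,e) \<in> E"
            using cyclic_neighbours_adj[of c x e ?T] CA[of c x] True x(1) ce xe by auto
          then show False using xe by simp
        qed
        then have "card F < card ?T" using FT fin by (intro psubset_card_mono) auto
        also have "\<dots> = card D"
          by (rule card_insert_Diff_singleton) (use fin x(1) ce D(1) in auto)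
        finally show ?thesis .
      next
        assume "F \<subseteq> R"
        then have "card F \<le> card R" using fin by (intro card_mono)
        then show ?thesis using card_R D(3) by simp
      qed
    qed
  qed
qed

lemma exists_connected_dominating_components:
  assumes "finite V" and V: "connected_in E V" and "card V \<le> 3 * k" and k: "1 \<le> k" "k \<le> card V"
    and "\<And>W. W \<subseteq> V \<Longrightarrow> pairwise (\<lambda>x y. (x,y) \<in> E) W \<Longrightarrow> card W \<le> 2 * k"
  obtains S where "S \<subseteq> V" "card S = k" "connected_in E S"
    "\<And>F. F \<subseteq> V - S \<Longrightarrow> connected_in E F \<Longrightarrow> card F \<le> k"
proof -
  define good where "good m S \<longleftrightarrow> S \<subseteq> V \<and> card S = k \<and> connected_in E S \<and>
    (\<forall>F\<subseteq>V - S. connected_in E F \<longrightarrow> card F \<le> m)" for m S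
  \<comment> \<open>The smallest size to which the largest component left by some connected
    \<open>k\<close>-set can be reduced.\<close>
  define m where "m = (LEAST m. \<exists>S. good m S)"
  obtain S\<^sub>0 where "S\<^sub>0 \<subseteq> V" "card S\<^sub>0 = k" "connected_in E S\<^sub>0"
    using connected_in_subset_card[OF sym_adj assms(1) V k] .
  then have "good (card V) S\<^sub>0"
    using assms(1) by (auto simp: good_def intro: card_mono)
  then have "\<exists>S. good m S" unfolding m_def by (rule LeastI2[of _ "card V", OF exI])
  then obtain S where S: "good m S" ..
  have least: "m \<le> j" if "good j S'" for j S'
    unfolding m_def using that by (blast intro: Least_le)
  have "m \<le> k"
  proof (rule ccontr)
    assume "\<not> m \<le> k"
    then have "k < m" by simp
    \<comment> \<open>The bound \<open>m\<close> is attained, for otherwise \<open>m - 1\<close>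
      would be a bound too.\<close>
    have "\<exists>D\<subseteq>V - S. connected_in E D \<and> card D = m"
    proof (rule ccontr)
      assume "\<not> ?thesis"
      then have "good (m - 1) S"
        using S unfolding good_def by (metis Suc_diff_1 \<open>k < m\<close> bot_nat_0.not_eq_extremum le_SucE not_less_zero)
      then show False using least \<open>k < m\<close> by fastforce
    qed
    then obtain D where D: "D \<subseteq> V - S" "connected_in E D" "card D = m" by blast
    \<comment> \<open>\<open>D\<close> already has the largest possible size, so it cannot be
      enlarged and is a component.\<close>
    have "(x,y) \<notin> E" if "x \<in> D" "y \<in> V - S - D" for x y
    proof
      assume "(x,y) \<in> E"
      then have "connected_in E (insert y D)"
        using connected_in_insert[OF sym_adj D(2)] that by blast
      then have "card (insert y D) \<le> m" using S D(1) that by (simp add: good_def)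
      moreover have "finite D" using D(1) assms(1) by (meson finite_Diff finite_subset)
      ultimately show False using D(3) that by simp
    qed
    then obtain S' where "S' \<subseteq> V" "card S' = k" "connected_in E S'"
      "\<And>F. F \<subseteq> V - S' \<Longrightarrow> connected_in E F \<Longrightarrow> card F < card D"
      using exchange_decreases_components[of V k S D] assms S D \<open>k < m\<close>
      unfolding good_def by metis
    moreover have "j \<le> m - 1" if "j < m" for j using that by simp
    ultimately have "good (m - 1) S'" using D(3) by (simp add: good_def)
    then show False using least[of "m - 1" S'] \<open>k < m\<close> by simp
  qed
  then show ?thesis using that[of S] S by (auto simp: good_def intro: le_trans)
qed

end

section \<open>Block graphs\<close>

lemma arcs_ends_induce: "arcs_ends (G \<restriction> X) = arcs_ends G \<inter> X \<times> X"
  by (auto simp: arcs_ends_conv)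

lemma rtrancl_on_Int_times: "rtrancl_on X (E \<inter> X \<times> X) = rtrancl_on X E"
proof (intro set_eqI iffI; clarify)
  fix u v
  assume "(u,v) \<in> rtrancl_on X (E \<inter> X \<times> X)"
  then show "(u,v) \<in> rtrancl_on X E" by (rule rtrancl_on_mono[rotated 2]) auto
next
  fix u v
  assume "(u,v) \<in> rtrancl_on X E"
  then show "(u,v) \<in> rtrancl_on X (E \<inter> X \<times> X)"
    by (induction rule: rtrancl_on_induct) (auto intro: rtrancl_on_into_rtrancl_on)
qed

lemma connected_induce_iff:
  assumes "graph G"
  shows "connected (G \<restriction> X) \<longleftrightarrow> connected_in (arcs_ends G) X"
proof -
  interpret graph G by fact
  have "(arcs_ends (G \<restriction> X))\<^sup>s = arcs_ends G \<inter> X \<times> X"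
    using sym_arcs by (auto simp: arcs_ends_induce symcl_def symmetric_def dest: symD)
  then show ?thesis by (simp add: connected_conv connected_in_def rtrancl_on_Int_times)
qed

lemma strongly_connected_imp_connected_in:
  assumes "strongly_connected H" "arcs_ends H \<subseteq> E"
  shows "connected_in E (verts H)"
  using assms(1) rtrancl_on_mono[OF assms(2) subset_refl]
  by (simp add: strongly_connected_def connected_in_def reachable_def)

lemma graph_induce:
  assumes "graph G" "X \<subseteq> verts G"
  shows "graph (G \<restriction> X)"
proof -
  interpret graph G by fact
  have ind: "induced_subgraph (G \<restriction> X) G" using assms(2) by auto
  interpret D: digraph "G \<restriction> X" using ind by (rule digraphI_induced)
  interpret S: sym_digraph "G \<restriction> X" using ind by (rule induced_graph_imp_graph)
  show ?thesis by unfold_locales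
qed

section \<open>Cycles and the blocks containing them\<close>

lemma connected_in_vwalk:
  assumes "sym E" "set (vwalk_arcs p) \<subseteq> E" "p \<noteq> []"
  shows "connected_in E (set p)"
  using assms(2,3)
proof (induction p rule: vwalk_arcs.induct)
  case (3 x y xs)
  then have "connected_in E (set (y # xs))" "(y,x) \<in> E" using assms(1) by (auto dest: symD)
  then show ?case using connected_in_insert[OF assms(1), of "set (y # xs)" y x] by simp
qed (simp_all add: connected_in_singleton)

lemma set_vwalk_arcs_append:
  "set (vwalk_arcs xs) \<union> set (vwalk_arcs ys) \<subseteq> set (vwalk_arcs (xs @ ys))"
proof (induction xs rule: vwalk_arcs.induct)
  case (2 x)
  then show ?case by (cases ys) auto
qed auto

lemma two_connected_induce_iff:
  assumes "graph G" "W \<subseteq> verts G"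
  shows "two_connected (G \<restriction> W) \<longleftrightarrow> 3 \<le> card W \<and> connected_in (arcs_ends G) W \<and>
    (\<forall>w\<in>W. connected_in (arcs_ends G) (W - {w}))"
proof -
  have "pre_digraph.del_vert (G \<restriction> W) w = G \<restriction> (W - {w})" for w
    by (auto simp: pre_digraph.del_vert_def induce_subgraph_def)
  then show ?thesis
    using assms by (simp add: two_connected_def graph_induce connected_induce_iff)
qed

lemma two_connected_in_block:
  assumes "graph G" "subgraph H G" "two_connected H"
  obtains B where "block G B" "subgraph H B" "subgraph B G"
proof -
  interpret graph G by fact
  let ?P = "\<lambda>B. subgraph B G \<and> two_connected B \<and> subgraph H B"
  \<comment> \<open>Subgraphs need not be induced, so a proper extension may add arcs only; the
    measure counts both.\<close>
  let ?f = "\<lambda>B. card (verts B) + card (arcs B)"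
  have fin: "finite (verts B)" "finite (arcs B)" if "subgraph B G" for B
    using fin_digraph_subgraph[OF that] by (auto intro: fin_digraph.finite_verts fin_digraph.finite_arcs)
  have "\<exists>B. ?P B \<and> (\<forall>B'. ?P B' \<longrightarrow> ?f B' \<le> ?f B)"
  proof (rule ex_has_greatest_nat)
    show "?P H" using assms by (auto intro: wf_digraph.subgraph_refl)
    show "\<forall>B. ?P B \<longrightarrow> ?f B < Suc (?f G)"
      by (auto simp: less_Suc_eq_le intro!: add_mono card_mono)
  qed
  then obtain B where B: "?P B" and max: "\<And>B'. ?P B' \<Longrightarrow> ?f B' \<le> ?f B" by blast
  have "max_subgraph two_connected B"
    unfolding max_subgraph_def
  proof (intro conjI allI impI notI)
    fix B' assume 1: "B' \<noteq> B \<and> subgraph B B'" and 2: "subgraph B' G \<and> two_connected B'"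
    then have "?P B'" using B by (blast intro: subgraph_trans)
    then have le: "?f B' \<le> ?f B" by (rule max)
    have sub: "verts B \<subseteq> verts B'" "arcs B \<subseteq> arcs B'" using 1 by auto
    have "card (verts B) \<le> card (verts B')" "card (arcs B) \<le> card (arcs B')"
      using sub fin[of B'] 2 by (auto intro: card_mono)
    then have "card (verts B') \<le> card (verts B)" "card (arcs B') \<le> card (arcs B)"
      using le by auto
    then have "verts B = verts B'" "arcs B = arcs B'"
      using sub fin[of B'] 2 by (simp_all add: card_seteq)
    then have "B' = B"
      using 1 by (auto simp: subgraph_def compatible_def intro: pre_digraph.equality)
    then show False using 1 by simp
  qed (use B in auto)
  then show ?thesis using that[of B] B by (auto simp: block_def)
qed

text \<open>A path from \<open>u\<close> to \<open>v\<close> avoiding \<open>c\<close> closes up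
  through \<open>c\<close> to a cycle. Its vertices induce a two-connected subgraph, which lies in a
  block, and that block is complete.\<close>

lemma block_graph_cyclic_neighbours_adj:
  assumes "block_graph G" and cu: "c \<rightarrow>\<^bsub>G\<^esub> u" and cv: "c \<rightarrow>\<^bsub>G\<^esub> v" and "u \<noteq> v"
    and "c \<notin> X" and uv: "(u,v) \<in> rtrancl_on X (arcs_ends G)"
  shows "u \<rightarrow>\<^bsub>G\<^esub> v"
proof -
  have "graph G" using assms(1) by (simp add: block_graph_def)
  interpret graph G by fact
  let ?E = "arcs_ends G"
  have symE: "sym ?E" using sym_arcs by (simp add: symmetric_def)
  interpret I: wf_digraph "G \<restriction> X" by (rule wellformed_induce_subgraph)
  have "u \<rightarrow>\<^sup>*\<^bsub>G \<restriction> X\<^esub> v"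
    using uv by (simp add: reachable_def arcs_ends_induce rtrancl_on_Int_times)
  then obtain p where p: "vpath p (G \<restriction> X)" "hd p = u" "last p = v"
    using I.reachable_vpath_conv by blast
  have "distinct p" "p \<noteq> []" "set p \<subseteq> X" using p(1) by (auto simp: vpath_def vwalk_def)
  have arcs: "set (vwalk_arcs p) \<subseteq> ?E"
    using p(1) by (auto simp: vpath_def vwalk_def arcs_ends_induce)
  have uvp: "u \<in> set p" "v \<in> set p" using p \<open>p \<noteq> []\<close> by auto
  have cp: "c \<notin> set p" using \<open>set p \<subseteq> X\<close> \<open>c \<notin> X\<close> by auto
  let ?W = "insert c (set p)"
  have conn_p: "connected_in ?E (set p)" using connected_in_vwalk[OF symE arcs] \<open>p \<noteq> []\<close> by simp
  \<comment> \<open>Deleting an inner vertex \<open>w\<close> of the cycle other than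
    \<open>c\<close> splits the path into two pieces, each empty or still containing an end adjacent
    to \<open>c\<close>; both pieces hang together through \<open>c\<close>.\<close>
  have insert_c: "connected_in ?E (insert c (set q))"
    if "set (vwalk_arcs q) \<subseteq> ?E" "q = [] \<or> u \<in> set q \<or> v \<in> set q" for q
  proof (cases "q = []")
    case True
    then show ?thesis by (simp add: connected_in_singleton)
  next
    case False
    have "(u,c) \<in> ?E" "(v,c) \<in> ?E" using cu cv symE by (auto dest: symD)
    with False that show ?thesis
      using connected_in_vwalk[OF symE that(1)] connected_in_insert[OF symE] by blast
  qed
  \<comment> \<open>\<open>X\<close> may contain elements that are not vertices of \<open>G\<close>,
    but the path reaches its vertices along arcs of \<open>G\<close>.\<close>
  have "set p \<subseteq> verts G"
  proof
    fix y assume y: "y \<in> set p"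
    have "(u,y) \<in> rtrancl_on (set p) ?E" using conn_p uvp y by (simp add: connected_in_def)
    then show "y \<in> verts G"
      by (induction rule: rtrancl_on_induct) (use cu in auto)
  qed
  then have W: "?W \<subseteq> verts G" using cu by auto
  have "two_connected (G \<restriction> ?W)"
    unfolding two_connected_induce_iff[OF \<open>graph G\<close> W]
  proof (intro conjI ballI)
    have "card {c,u,v} \<le> card ?W" using uvp by (intro card_mono) auto
    moreover have "c \<noteq> u" "c \<noteq> v" using uvp cp by auto
    then have "card {c,u,v} = 3" using \<open>u \<noteq> v\<close> by simp
    ultimately show "3 \<le> card ?W" by simp
    show "connected_in ?E ?W" using insert_c[OF arcs] uvp by blast
  next
    fix w assume w: "w \<in> ?W"
    show "connected_in ?E (?W - {w})"
    proof (cases "w = c")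
      case True
      then show ?thesis using conn_p cp by simp
    next
      case False
      then obtain ys zs where split: "p = ys @ w # zs" using w by (auto dest: split_list)
      have "connected_in ?E (insert c (set ys))"
      proof (rule insert_c)
        show "set (vwalk_arcs ys) \<subseteq> ?E"
          using arcs set_vwalk_arcs_append[of ys "w # zs"] split by blast
        show "ys = [] \<or> u \<in> set ys \<or> v \<in> set ys" using p(2) split by (cases ys) auto
      qed
      moreover have "connected_in ?E (insert c (set zs))"
      proof (rule insert_c)
        show "set (vwalk_arcs zs) \<subseteq> ?E"
          using arcs set_vwalk_arcs_append[of "ys @ [w]" zs] split by auto
        show "zs = [] \<or> u \<in> set zs \<or> v \<in> set zs" using p(3) split by (cases "zs = []") auto
      qed
      moreover have "?W - {w} = insert c (set ys) \<union> insert c (set zs)"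
        using split \<open>distinct p\<close> False by auto
      ultimately show ?thesis
        using connected_in_Un[of ?E "insert c (set ys)" "insert c (set zs)"] by simp
    qed
  qed
  moreover have "subgraph (G \<restriction> ?W) G" using W by (blast intro: induced_imp_subgraph)
  ultimately obtain B where B: "block G B" "subgraph (G \<restriction> ?W) B" "subgraph B G"
    using two_connected_in_block[OF \<open>graph G\<close>] by metis
  have "complete_graph B" using assms(1) B(1) by (simp add: block_graph_def)
  moreover have "u \<in> verts B" "v \<in> verts B" using subgraph_imp_subverts[OF B(2)] uvp by auto
  ultimately have "(u,v) \<in> arcs_ends B"
    using \<open>u \<noteq> v\<close> by (simp add: complete_graph_def complete_digraph_def)
  then show ?thesis using B(3) by (rule adj_mono)
qed

section \<open>Cliques, safe sets and the final bound\<close>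

lemma complete_graph_induce_iff:
  assumes "graph G" "W \<subseteq> verts G"
  shows "complete_graph (G \<restriction> W) \<longleftrightarrow> pairwise (\<lambda>x y. x \<rightarrow>\<^bsub>G\<^esub> y) W"
proof -
  interpret graph G by fact
  show ?thesis
    using graph_induce[OF assms] adj_not_same
    by (auto simp: complete_graph_def complete_digraph_def pairwise_def arcs_ends_induce)
qed

text \<open>A connected \<open>S\<close> is the only component of its induced subgraph, so it
  suffices to compare its size with every connected set outside it.\<close>

lemma safe_setI:
  assumes "graph G" "S \<subseteq> verts G" "connected_in (arcs_ends G) S"
    and "\<And>F. F \<subseteq> verts G - S \<Longrightarrow> connected_in (arcs_ends G) F \<Longrightarrow> card F \<le> card S"
  shows "safe_set G S"
  unfolding safe_set_def
proof (intro conjI ballI impI)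
  interpret graph G by fact
  fix C D
  assume C: "C \<in> pre_digraph.sccs (G \<restriction> S)"
    and D: "D \<in> pre_digraph.sccs (G \<restriction> (verts G - S))"
  interpret I: graph "G \<restriction> S" using graph_induce assms by blast
  have "strongly_connected (G \<restriction> S)"
    using assms connected_induce_iff I.sym_arcs I.symmetric_connected_imp_strongly_connected by blast
  moreover have "verts C \<subseteq> S"
    using C by (auto simp: pre_digraph.sccs_def dest!: induced_imp_subgraph subgraph_imp_subverts)
  ultimately have "verts C = S"
    using C I.induced_subgraph_refl unfolding pre_digraph.sccs_def
    by (metis (no_types, lifting) induce_subgraph_verts mem_Collect_eq psubsetI)
  have Dsub: "subgraph D (G \<restriction> (verts G - S))" and Dsc: "strongly_connected D"
    using D by (auto simp: pre_digraph.sccs_def)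
  have "arcs_ends D \<subseteq> arcs_ends G"
    using arcs_ends_mono[OF Dsub] by (auto simp: arcs_ends_induce)
  then have "connected_in (arcs_ends G) (verts D)"
    by (rule strongly_connected_imp_connected_in[OF Dsc])
  moreover have "verts D \<subseteq> verts G - S" using subgraph_imp_subverts[OF Dsub] by simp
  ultimately show "card (verts D) \<le> card (verts C)" using assms(4) \<open>verts C = S\<close> by blast
qed (use assms in auto)

theorem theorem6:
  fixes G :: "('a,'b) pre_digraph" and n \<omega> :: nat
  assumes "block_graph G"
    and "connected G"
    and "card (verts G) = n"
    and "clique_number G = \<omega>"
  shows "int (connected_safe_number G) \<le> max \<lceil>real n / 3\<rceil> \<lceil>real \<omega> / 2\<rceil>"
proof -
  have "graph G" using assms(1) by (simp add: block_graph_def)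
  interpret graph G by fact
  let ?E = "arcs_ends G"
  interpret block_adjacency ?E
  proof
    show "sym ?E" using sym_arcs by (simp add: symmetric_def)
  qed (rule block_graph_cyclic_neighbours_adj[OF assms(1)])
  define k where "k = nat (max \<lceil>real n / 3\<rceil> \<lceil>real \<omega> / 2\<rceil>)"
  have "G \<restriction> verts G = G" by (rule induce_eq_iff_induced[OF induced_subgraph_refl])
  then have conn: "connected_in ?E (verts G)"
    using assms(2) connected_induce_iff[OF \<open>graph G\<close>, of "verts G"] by simp
  then have "1 \<le> n" using assms(3) by (auto simp: connected_in_def Suc_le_eq card_gt_0_iff)
  let ?Q = "{card W | W. W \<subseteq> verts G \<and> complete_graph (G \<restriction> W)}"
  have "?Q \<subseteq> {..n}" using assms(3) by (auto intro: card_mono)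
  then have finQ: "finite ?Q" by (rule finite_subset) simp
  have clique_le: "card W \<le> \<omega>" if "W \<subseteq> verts G" "pairwise (\<lambda>x y. (x,y) \<in> ?E) W" for W
    using that complete_graph_induce_iff[OF \<open>graph G\<close>] finQ assms(4)
    unfolding clique_number_def by (blast intro: Max_ge)
  \<comment> \<open>The empty clique makes the set nonempty, so that its \<open>Max\<close> is
    attained and \<open>\<omega>\<close> is at most \<open>n\<close>.\<close>
  have "card {} \<in> ?Q"
    using complete_graph_induce_iff[OF \<open>graph G\<close>, of "{}"] by (intro CollectI exI[of _ "{}"]) simp
  then have "\<omega> \<in> ?Q" using Max_in[OF finQ] assms(4) unfolding clique_number_def by blast
  then have "\<omega> \<le> n" using \<open>?Q \<subseteq> {..n}\<close> by auto
  have "0 \<le> \<lceil>real n / 3\<rceil>" by simp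
  then have k_eq: "int k = max \<lceil>real n / 3\<rceil> \<lceil>real \<omega> / 2\<rceil>"
    unfolding k_def by linarith
  have "\<lceil>real n / 3\<rceil> \<le> int k" "\<lceil>real \<omega> / 2\<rceil> \<le> int k"
    using k_eq by simp_all
  then have k_ge: "n \<le> 3 * k" "\<omega> \<le> 2 * k" by linarith+
  \<comment> \<open>A connected set of \<open>k\<close> vertices exists only if \<open>k\<close> is
    at most \<open>n\<close>; for the clique term this rests on
    \<open>\<omega> \<le> n\<close>.\<close>
  have "\<lceil>real n / 3\<rceil> \<le> int n" "\<lceil>real \<omega> / 2\<rceil> \<le> int \<omega>" by linarith+
  then have "k \<le> n" using k_eq \<open>\<omega> \<le> n\<close> by linarith
  moreover have "1 \<le> k" using k_ge \<open>1 \<le> n\<close> by linarith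
  moreover have "card W \<le> 2 * k" if "W \<subseteq> verts G" "pairwise (\<lambda>x y. (x,y) \<in> ?E) W" for W
    using clique_le[OF that] k_ge(2) by simp
  ultimately obtain S where S: "S \<subseteq> verts G" "card S = k" "connected_in ?E S"
    "\<And>F. F \<subseteq> verts G - S \<Longrightarrow> connected_in ?E F \<Longrightarrow> card F \<le> k"
    using exists_connected_dominating_components[OF finite_verts conn, of k] assms(3) k_ge(1)
    by blast
  let ?M = "{card S | S. safe_set G S \<and> connected (G \<restriction> S)}"
  have "safe_set G S" using safe_setI[OF \<open>graph G\<close> S(1,3)] S(2,4) by simp
  then have "k \<in> ?M" using S(2,3) connected_induce_iff[OF \<open>graph G\<close>] by blast
  moreover have "?M \<subseteq> {..n}" using assms(3) by (auto simp: safe_set_def intro: card_mono)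
  then have "finite ?M" by (rule finite_subset) simp
  ultimately have "connected_safe_number G \<le> k"
    unfolding connected_safe_number_def by (intro Min_le)
  then show ?thesis using k_eq by simp
qed

end
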